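(* Let $G$ be a group, let $\mathscr{C}$ and $\mathscr{D}$ be $G$-categories, and let $\mathscr{C}\to\mathscr{D}$ be a pseudo equivariant functor. Then there is an induced on the nose equivariant functor $\mathrm{Cat}(\widetilde G,\mathscr{C})\to\mathrm{Cat}(\widetilde G,\mathscr{D})$, so there are induced maps on homotopy fixed point categories $\mathscr{C}^{hH}\to\mathscr{D}^{hH}$ for all subgroups $H$ of $G$.
   Context: A $G$-category is a category $\mathscr{C}$ with endofunctors $(g\cdot)$, $g\in G$, such that $(e\cdot)=\mathrm{id}$ and $(g\cdot)\circ(h\cdot)=(gh)\cdot$; a functor between $G$-categories is (on the nose) equivariant if it strictly commutes with these. For a subgroup $H\subseteq G$, $\mathscr{C}^H$ is the subcategory of $H$-fixed objects and $H$-fixed morphisms. $\widetilde G$ is the category with objects the elements of $G$ and a unique morphism between any two objects, with $G$ acting by translation on objects and diagonally on morphisms. $\mathrm{Cat}(\widetilde G,\mathscr{C})$ is the $G$-category of all functors $\widetilde G\to\mathscr{C}$ and all natural transformations, with $G$ acting by conjugation: $(gF)(x)=gF(g^{-1}x)$ and $(g\eta)_x=g\,\eta_{g^{-1}x}$. The homotopy fixed point category is $\mathscr{C}^{hH}=\mathrm{Cat}(\widetilde G,\mathscr{C})^H$. A pseudo equivariant functor $\mathscr{C}\to\mathscr{D}$ is a functor $\Theta:\mathscr{C}\to\mathscr{D}$ together with natural isomorphisms $\theta_g:\Theta\circ(g\cdot)\Rightarrow(g\cdot)\circ\Theta$ for all $g\in G$ (with components $\theta_g(C):\Theta(gC)\to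 g\Theta(C)$) such that $\theta_e=\mathrm{id}$ and $\theta_{gh}(C)=\big(g\,\theta_h(C)\big)\circ\theta_g(hC)$ for all $g,h\in G$ and all objects $C$ of $\mathscr{C}$. *)

theory Defs
  imports "HOL-Algebra.Group"
begin

record ('o, 'm) cat =
  Obj :: "'o set"
  Arr :: "'m set"
  Dom :: "'m \<Rightarrow> 'o"
  Cod :: "'m \<Rightarrow> 'o"
  Ident :: "'o \<Rightarrow> 'm"
  Comp :: "'m \<Rightarrow> 'm \<Rightarrow> 'm"  \<comment> \<open>\<open>Comp C g f\<close> is \<open>g\<close> after \<open>f\<close>\<close>

definition Hom :: "('o, 'm, 'z) cat_scheme \<Rightarrow> 'o \<Rightarrow> 'o \<Rightarrow> 'm set" where
  "Hom C x y = {f \<in> Arr C. Dom C f = x \<and> Cod C f = y}"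

locale category =
  fixes C :: "('o, 'm, 'z) cat_scheme" (structure)
  assumes dom_obj: "f \<in> Arr C \<Longrightarrow> Dom C f \<in> Obj C"
    and cod_obj: "f \<in> Arr C \<Longrightarrow> Cod C f \<in> Obj C"
    and ident_hom: "x \<in> Obj C \<Longrightarrow> Ident C x \<in> Hom C x x"
    and comp_hom: "\<lbrakk>f \<in> Hom C x y; g \<in> Hom C y z\<rbrakk> \<Longrightarrow> Comp C g f \<in> Hom C x z"
    and ident_left: "f \<in> Hom C x y \<Longrightarrow> Comp C (Ident C y) f = f"
    and ident_right: "f \<in> Hom C x y \<Longrightarrow> Comp C f (Ident C x) = f"
    and comp_assoc: "\<lbrakk>f \<in> Hom C w x; g \<in> Hom C x y; h \<in> Hom C y z\<rbrakk>
      \<Longrightarrow> Comp C (Comp C h g) f = Comp C h (Comp C g f)"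

definition iso_arr :: "('o, 'm, 'z) cat_scheme \<Rightarrow> 'm \<Rightarrow> bool" where
  "iso_arr C f \<longleftrightarrow> f \<in> Arr C \<and>
     (\<exists>g \<in> Hom C (Cod C f) (Dom C f).
        Comp C g f = Ident C (Dom C f) \<and> Comp C f g = Ident C (Cod C f))"

record ('o1, 'm1, 'o2, 'm2) func =
  fobj :: "'o1 \<Rightarrow> 'o2"
  fmap :: "'m1 \<Rightarrow> 'm2"

text \<open>
  Functors and natural transformations take the value \<^term>\<open>undefined\<close> off their domains
  (\<open>\<rightarrow>\<^sub>E\<close>, \<^const>\<open>extensional\<close>, \<^const>\<open>compose\<close>), so that HOL equality of the representing
  records is equality of functors, respectively of natural transformations.
\<close>

locale cat_functor = source: category A + target: category B
  for A :: "('o1, 'm1, 'y) cat_scheme" and B :: "('o2, 'm2, 'z) cat_scheme" +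
  fixes F :: "('o1, 'm1, 'o2, 'm2) func"
  assumes fobj_maps: "fobj F \<in> Obj A \<rightarrow>\<^sub>E Obj B"
    and fmap_maps: "fmap F \<in> Arr A \<rightarrow>\<^sub>E Arr B"
    and fmap_hom: "f \<in> Hom A x y \<Longrightarrow> fmap F f \<in> Hom B (fobj F x) (fobj F y)"
    and fmap_ident: "x \<in> Obj A \<Longrightarrow> fmap F (Ident A x) = Ident B (fobj F x)"
    and fmap_comp: "\<lbrakk>f \<in> Hom A x y; g \<in> Hom A y z\<rbrakk>
      \<Longrightarrow> fmap F (Comp A g f) = Comp B (fmap F g) (fmap F f)"

definition id_func :: "('o, 'm, 'z) cat_scheme \<Rightarrow> ('o, 'm, 'o, 'm) func" where
  "id_func A = \<lparr>fobj = (\<lambda>x \<in> Obj A. x), fmap = (\<lambda>f \<in> Arr A. f)\<rparr>"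

text \<open>\<open>comp_func A K F\<close> is the composite \<open>K \<circ> F\<close>, where \<open>A\<close> is the source of \<open>F\<close>.\<close>

definition comp_func :: "('o1, 'm1, 'z) cat_scheme \<Rightarrow> ('o2, 'm2, 'o3, 'm3) func
    \<Rightarrow> ('o1, 'm1, 'o2, 'm2) func \<Rightarrow> ('o1, 'm1, 'o3, 'm3) func" where
  "comp_func A K F =
     \<lparr>fobj = compose (Obj A) (fobj K) (fobj F), fmap = compose (Arr A) (fmap K) (fmap F)\<rparr>"

definition restrict_func :: "('o1, 'm1, 'z) cat_scheme \<Rightarrow> ('o1, 'm1, 'o2, 'm2) func
    \<Rightarrow> ('o1, 'm1, 'o2, 'm2) func" where
  "restrict_func A F = \<lparr>fobj = restrict (fobj F) (Obj A), fmap = restrict (fmap F) (Arr A)\<rparr>"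

record ('o1, 'm1, 'o2, 'm2) nat_trans =
  nt_dom :: "('o1, 'm1, 'o2, 'm2) func"
  nt_cod :: "('o1, 'm1, 'o2, 'm2) func"
  nt_at :: "'o1 \<Rightarrow> 'm2"

locale natural_transformation =
  dom: cat_functor A B "nt_dom \<eta>" + cod: cat_functor A B "nt_cod \<eta>"
  for A :: "('o1, 'm1, 'y) cat_scheme" and B :: "('o2, 'm2, 'z) cat_scheme"
    and \<eta> :: "('o1, 'm1, 'o2, 'm2) nat_trans" +
  assumes nt_ext: "nt_at \<eta> \<in> extensional (Obj A)"
    and nt_hom: "x \<in> Obj A \<Longrightarrow> nt_at \<eta> x \<in> Hom B (fobj (nt_dom \<eta>) x) (fobj (nt_cod \<eta>) x)"
    and nt_natural: "f \<in> Hom A x y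
      \<Longrightarrow> Comp B (nt_at \<eta> y) (fmap (nt_dom \<eta>) f) = Comp B (fmap (nt_cod \<eta>) f) (nt_at \<eta> x)"

locale natural_isomorphism = natural_transformation +
  assumes nt_iso: "x \<in> Obj A \<Longrightarrow> iso_arr B (nt_at \<eta> x)"

definition id_nt :: "('o1, 'm1, 'y) cat_scheme \<Rightarrow> ('o2, 'm2, 'z) cat_scheme
    \<Rightarrow> ('o1, 'm1, 'o2, 'm2) func \<Rightarrow> ('o1, 'm1, 'o2, 'm2) nat_trans" where
  "id_nt A B F = \<lparr>nt_dom = F, nt_cod = F, nt_at = (\<lambda>x \<in> Obj A. Ident B (fobj F x))\<rparr>"

definition comp_nt :: "('o1, 'm1, 'y) cat_scheme \<Rightarrow> ('o2, 'm2, 'z) cat_scheme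
    \<Rightarrow> ('o1, 'm1, 'o2, 'm2) nat_trans \<Rightarrow> ('o1, 'm1, 'o2, 'm2) nat_trans
    \<Rightarrow> ('o1, 'm1, 'o2, 'm2) nat_trans" where
  "comp_nt A B \<mu> \<eta> = \<lparr>nt_dom = nt_dom \<eta>, nt_cod = nt_cod \<mu>,
     nt_at = (\<lambda>x \<in> Obj A. Comp B (nt_at \<mu> x) (nt_at \<eta> x))\<rparr>"

definition whisker :: "('o1, 'm1, 'z) cat_scheme \<Rightarrow> ('o2, 'm2, 'o3, 'm3) func
    \<Rightarrow> ('o1, 'm1, 'o2, 'm2) nat_trans \<Rightarrow> ('o1, 'm1, 'o3, 'm3) nat_trans" where
  "whisker A K \<eta> = \<lparr>nt_dom = comp_func A K (nt_dom \<eta>), nt_cod = comp_func A K (nt_cod \<eta>),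
     nt_at = (\<lambda>x \<in> Obj A. fmap K (nt_at \<eta> x))\<rparr>"

definition functor_cat :: "('o1, 'm1, 'y) cat_scheme \<Rightarrow> ('o2, 'm2, 'z) cat_scheme
    \<Rightarrow> (('o1, 'm1, 'o2, 'm2) func, ('o1, 'm1, 'o2, 'm2) nat_trans) cat" where
  "functor_cat A B =
     \<lparr>Obj = {F. cat_functor A B F}, Arr = {\<eta>. natural_transformation A B \<eta>},
      Dom = nt_dom, Cod = nt_cod, Ident = id_nt A B, Comp = comp_nt A B\<rparr>"

text \<open>Postcomposition with \<open>K : B \<rightarrow> B'\<close>, as a functor \<open>Cat(A, B) \<rightarrow> Cat(A, B')\<close>.\<close>

definition postcomp :: "('o1, 'm1, 'y) cat_scheme \<Rightarrow> ('o2, 'm2, 'z) cat_scheme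
    \<Rightarrow> ('o2, 'm2, 'o3, 'm3) func
    \<Rightarrow> (('o1, 'm1, 'o2, 'm2) func, ('o1, 'm1, 'o2, 'm2) nat_trans,
        ('o1, 'm1, 'o3, 'm3) func, ('o1, 'm1, 'o3, 'm3) nat_trans) func" where
  "postcomp A B K =
     \<lparr>fobj = (\<lambda>F \<in> Obj (functor_cat A B). comp_func A K F),
      fmap = (\<lambda>\<eta> \<in> Arr (functor_cat A B). whisker A K \<eta>)\<rparr>"

record ('o, 'm, 'g) gcat = "('o, 'm) cat" +
  act :: "'g \<Rightarrow> ('o, 'm, 'o, 'm) func"

locale G_category = group G + category C
  for G :: "('g, 'x) monoid_scheme" (structure) and C :: "('o, 'm, 'g, 'z) gcat_scheme" +
  assumes act_functor: "g \<in> carrier G \<Longrightarrow> cat_functor C C (act C g)"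
    and act_one: "act C \<one> = id_func C"
    and act_mult: "\<lbrakk>g \<in> carrier G; h \<in> carrier G\<rbrakk>
      \<Longrightarrow> comp_func C (act C g) (act C h) = act C (g \<otimes> h)"

locale equivariant_functor =
  source: G_category G C + target: G_category G D + cat_functor C D F
  for G :: "('g, 'x) monoid_scheme" (structure)
    and C :: "('o1, 'm1, 'g, 'y) gcat_scheme" and D :: "('o2, 'm2, 'g, 'z) gcat_scheme"
    and F :: "('o1, 'm1, 'o2, 'm2) func" +
  assumes equivariant: "g \<in> carrier G
    \<Longrightarrow> comp_func C F (act C g) = comp_func C (act D g) F"

locale pseudo_equivariant_functor =
  source: G_category G C + target: G_category G D + cat_functor C D \<Theta>
  for G :: "('g, 'x) monoid_scheme" (structure)
    and C :: "('o1, 'm1, 'g, 'y) gcat_scheme" and D :: "('o2, 'm2, 'g, 'z) gcat_scheme"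
    and \<Theta> :: "('o1, 'm1, 'o2, 'm2) func" +
  fixes \<theta> :: "'g \<Rightarrow> ('o1, 'm1, 'o2, 'm2) nat_trans"
  assumes theta_iso: "g \<in> carrier G \<Longrightarrow> natural_isomorphism C D (\<theta> g)"
    and theta_dom: "g \<in> carrier G \<Longrightarrow> nt_dom (\<theta> g) = comp_func C \<Theta> (act C g)"
    and theta_cod: "g \<in> carrier G \<Longrightarrow> nt_cod (\<theta> g) = comp_func C (act D g) \<Theta>"
    and theta_one: "\<theta> \<one> = id_nt C D \<Theta>"
    and theta_mult: "\<lbrakk>g \<in> carrier G; h \<in> carrier G; c \<in> Obj C\<rbrakk>
      \<Longrightarrow> nt_at (\<theta> (g \<otimes> h)) c
          = Comp D (fmap (act D g) (nt_at (\<theta> h) c)) (nt_at (\<theta> g) (fobj (act C h) c))"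

definition fixed_cat :: "('o, 'm, 'g, 'z) gcat_scheme \<Rightarrow> 'g set \<Rightarrow> ('o, 'm) cat" where
  "fixed_cat C H =
     \<lparr>Obj = {x \<in> Obj C. \<forall>h \<in> H. fobj (act C h) x = x},
      Arr = {f \<in> Arr C. \<forall>h \<in> H. fmap (act C h) f = f},
      Dom = Dom C, Cod = Cod C, Ident = Ident C, Comp = Comp C\<rparr>"

text \<open>The pair \<open>(x, y)\<close> encodes the unique morphism \<open>x \<rightarrow> y\<close>.\<close>

definition translation_cat ::
    "('g, 'x) monoid_scheme \<Rightarrow> ('g, 'g \<times> 'g, 'g) gcat" where
  "translation_cat G =
     \<lparr>Obj = carrier G, Arr = carrier G \<times> carrier G, Dom = fst, Cod = snd,
      Ident = (\<lambda>x. (x, x)), Comp = (\<lambda>v u. (fst u, snd v)),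
      act = (\<lambda>g. \<lparr>fobj = (\<lambda>x \<in> carrier G. g \<otimes>\<^bsub>G\<^esub> x),
                  fmap = (\<lambda>(x, y) \<in> carrier G \<times> carrier G. (g \<otimes>\<^bsub>G\<^esub> x, g \<otimes>\<^bsub>G\<^esub> y))\<rparr>)\<rparr>"

definition conj_func :: "('g, 'x) monoid_scheme \<Rightarrow> ('o1, 'm1, 'g, 'y) gcat_scheme
    \<Rightarrow> ('o2, 'm2, 'g, 'z) gcat_scheme \<Rightarrow> 'g
    \<Rightarrow> ('o1, 'm1, 'o2, 'm2) func \<Rightarrow> ('o1, 'm1, 'o2, 'm2) func" where
  "conj_func G A C g F = comp_func A (act C g) (comp_func A F (act A (inv\<^bsub>G\<^esub> g)))"

definition conj_nt :: "('g, 'x) monoid_scheme \<Rightarrow> ('o1, 'm1, 'g, 'y) gcat_scheme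
    \<Rightarrow> ('o2, 'm2, 'g, 'z) gcat_scheme \<Rightarrow> 'g
    \<Rightarrow> ('o1, 'm1, 'o2, 'm2) nat_trans \<Rightarrow> ('o1, 'm1, 'o2, 'm2) nat_trans" where
  "conj_nt G A C g \<eta> =
     \<lparr>nt_dom = conj_func G A C g (nt_dom \<eta>), nt_cod = conj_func G A C g (nt_cod \<eta>),
      nt_at = (\<lambda>x \<in> Obj A. fmap (act C g) (nt_at \<eta> (fobj (act A (inv\<^bsub>G\<^esub> g)) x)))\<rparr>"

definition functor_gcat :: "('g, 'x) monoid_scheme \<Rightarrow> ('o1, 'm1, 'g, 'y) gcat_scheme
    \<Rightarrow> ('o2, 'm2, 'g, 'z) gcat_scheme
    \<Rightarrow> (('o1, 'm1, 'o2, 'm2) func, ('o1, 'm1, 'o2, 'm2) nat_trans, 'g) gcat" where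
  "functor_gcat G A C = cat.extend (functor_cat A C)
     \<lparr>act = (\<lambda>g. \<lparr>fobj = restrict (conj_func G A C g) (Obj (functor_cat A C)),
                  fmap = restrict (conj_nt G A C g) (Arr (functor_cat A C))\<rparr>)\<rparr>"

abbreviation Cat_tilde :: "('g, 'x) monoid_scheme \<Rightarrow> ('o, 'm, 'g, 'z) gcat_scheme
    \<Rightarrow> (('g, 'g \<times> 'g, 'o, 'm) func, ('g, 'g \<times> 'g, 'o, 'm) nat_trans, 'g) gcat" where
  "Cat_tilde G C \<equiv> functor_gcat G (translation_cat G) C"

definition htpy_fixed_cat :: "('g, 'x) monoid_scheme \<Rightarrow> ('o, 'm, 'g, 'z) gcat_scheme
    \<Rightarrow> 'g set \<Rightarrow> (('g, 'g \<times> 'g, 'o, 'm) func, ('g, 'g \<times> 'g, 'o, 'm) nat_trans) cat" where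
  "htpy_fixed_cat G C H = fixed_cat (Cat_tilde G C) H"

text \<open>
  The functor induced by a pseudo equivariant functor \<open>(\<Theta>, \<theta>)\<close>: postcomposition
  with \<open>\<Theta>\<close> is in general not equivariant, and \<open>\<Phi>\<close> is its replacement along the isomorphisms
  \<open>\<theta>\<^sub>x(x\<inverse> F(x)) : \<Theta>(F(x)) = \<Theta>(x x\<inverse> F(x)) \<rightarrow> x \<Theta>(x\<inverse> F(x))\<close>, natural in \<open>x\<close> and in \<open>F\<close>.
  This determines \<open>\<Phi>\<close>: necessarily \<open>\<Phi>(F)(x) = x \<Theta>(x\<inverse> F(x))\<close>, and naturality fixes
  \<open>\<Phi>(F)\<close> on morphisms as well as \<open>\<Phi>\<close> on natural transformations.
\<close>

definition induced_by_pseudo :: "('g, 'x) monoid_scheme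
    \<Rightarrow> ('o1, 'm1, 'g, 'y) gcat_scheme \<Rightarrow> ('o2, 'm2, 'g, 'z) gcat_scheme
    \<Rightarrow> ('o1, 'm1, 'o2, 'm2) func \<Rightarrow> ('g \<Rightarrow> ('o1, 'm1, 'o2, 'm2) nat_trans)
    \<Rightarrow> (('g, 'g \<times> 'g, 'o1, 'm1) func, ('g, 'g \<times> 'g, 'o1, 'm1) nat_trans,
        ('g, 'g \<times> 'g, 'o2, 'm2) func, ('g, 'g \<times> 'g, 'o2, 'm2) nat_trans) func
    \<Rightarrow> bool" where
  "induced_by_pseudo G C D \<Theta> \<theta> \<Phi> \<longleftrightarrow>
     (\<exists>\<alpha>. natural_isomorphism (Cat_tilde G C) (Cat_tilde G D) \<alpha> \<and>
          nt_dom \<alpha> = postcomp (translation_cat G) C \<Theta> \<and> nt_cod \<alpha> = \<Phi> \<and>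
          (\<forall>F \<in> Obj (Cat_tilde G C). \<forall>x \<in> carrier G.
             nt_at (nt_at \<alpha> F) x = nt_at (\<theta> x) (fobj (act C (inv\<^bsub>G\<^esub> x)) (fobj F x))))"

end

theory Submission
  imports Defs
begin

text \<open>
  Postcomposition with \<open>\<Theta>\<close> is replaced by an isomorphic functor by transport of structure, twice:
  for each \<open>F\<close>, the functor \<open>\<Theta> \<circ> F\<close> is transported along the isomorphisms
  \<open>a F x = \<theta>\<^sub>x(x\<inverse> F(x))\<close> to a functor \<open>\<Phi>(F)\<close>, and then \<open>F \<mapsto> \<Theta> \<circ> F\<close> is transported along
  the isomorphisms \<open>a F : \<Theta> \<circ> F \<rightarrow> \<Phi>(F)\<close>. The cocycle condition gives
  \<open>a (gF) x = g (a F (g\<inverse> x)) \<circ> \<theta>\<^sub>g(F(g\<inverse> x))\<close>. Equivariance of \<open>\<Phi>\<close> follows by precomposing both sides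
  with the isomorphism \<open>a (gF) x\<close> and using the naturality of \<open>a\<close> and of \<open>\<theta>\<^sub>g\<close>.
\<close>

section \<open>Categories, functors and natural transformations\<close>

lemma HomI: "\<lbrakk>f \<in> Arr C; Dom C f = x; Cod C f = y\<rbrakk> \<Longrightarrow> f \<in> Hom C x y"
  by (simp add: Hom_def)

lemma HomD:
  assumes "f \<in> Hom C x y"
  shows "f \<in> Arr C" "Dom C f = x" "Cod C f = y"
  using assms by (simp_all add: Hom_def)

context category
begin

lemma ident_arr:
  assumes "x \<in> Obj C"
  shows "Ident C x \<in> Arr C" "Dom C (Ident C x) = x" "Cod C (Ident C x) = x"
  using HomD[OF ident_hom[OF assms]] by auto

lemma comp_arr:
  assumes "f \<in> Arr C" "g \<in> Arr C" "Cod C f = Dom C g"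
  shows "Comp C g f \<in> Arr C" "Dom C (Comp C g f) = Dom C f" "Cod C (Comp C g f) = Cod C g"
  using HomD[OF comp_hom[OF HomI[OF assms(1) refl refl] HomI[OF assms(2) assms(3)[symmetric] refl]]]
  by auto

lemma comp_ident_left: "\<lbrakk>f \<in> Arr C; Cod C f = y\<rbrakk> \<Longrightarrow> Comp C (Ident C y) f = f"
  by (auto intro: ident_left HomI)

lemma comp_ident_right: "\<lbrakk>f \<in> Arr C; Dom C f = x\<rbrakk> \<Longrightarrow> Comp C f (Ident C x) = f"
  by (auto intro: ident_right HomI)

lemma arr_comp_assoc:
  "\<lbrakk>f \<in> Arr C; g \<in> Arr C; h \<in> Arr C; Cod C f = Dom C g; Cod C g = Dom C h\<rbrakk>
    \<Longrightarrow> Comp C (Comp C h g) f = Comp C h (Comp C g f)"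
  by (rule comp_assoc) (auto intro: HomI)

text \<open>As a simp set these nest composites to the right and cancel identities. Side conditions
  are equations between \<open>Dom\<close> and \<open>Cod\<close>, which the simplifier can check;
  the \<open>Hom\<close> axioms would leave it to guess intermediate objects.\<close>

lemmas arr_simps = dom_obj cod_obj ident_arr comp_arr comp_ident_left comp_ident_right
  arr_comp_assoc

text \<open>An isomorphism is epi: compose both sides with its inverse on the right. The
  equivariance proof uses this to compare arrows without an explicit formula for them.\<close>

lemma iso_arr_cancel_right:
  assumes "iso_arr C a" and f: "f \<in> Arr C" "Dom C f = Cod C a"
    and g: "g \<in> Arr C" "Dom C g = Cod C a" and eq: "Comp C f a = Comp C g a"
  shows "f = g"
proof -
  obtain b where a: "a \<in> Arr C" and b: "b \<in> Arr C" "Dom C b = Cod C a" "Cod C b = Dom C a"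
    and ab: "Comp C a b = Ident C (Cod C a)"
    using assms(1) unfolding iso_arr_def Hom_def by auto
  have "f = Comp C (Comp C f a) b"
    using a b f ab by (simp add: arr_simps)
  also have "\<dots> = g"
    unfolding eq using a b g ab by (simp add: arr_simps)
  finally show ?thesis .
qed

end

section \<open>Functors\<close>

context cat_functor
begin

lemma fobj_obj: "x \<in> Obj A \<Longrightarrow> fobj F x \<in> Obj B"
  using fobj_maps by auto

lemma fmap_arr:
  assumes "f \<in> Arr A"
  shows "fmap F f \<in> Arr B" "Dom B (fmap F f) = fobj F (Dom A f)"
    "Cod B (fmap F f) = fobj F (Cod A f)"
  using HomD[OF fmap_hom[OF HomI[OF assms refl refl]]] by auto

lemma fmap_arr_comp:
  "\<lbrakk>f \<in> Arr A; g \<in> Arr A; Cod A f = Dom A g\<rbrakk>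
    \<Longrightarrow> fmap F (Comp A g f) = Comp B (fmap F g) (fmap F f)"
  by (rule fmap_comp) (auto intro: HomI)

lemmas functor_simps = fobj_obj fmap_arr fmap_arr_comp fmap_ident

end

lemma cat_functorI:
  assumes "category A" "category B"
    and "fobj F \<in> extensional (Obj A)" "fmap F \<in> extensional (Arr A)"
    and "\<And>x. x \<in> Obj A \<Longrightarrow> fobj F x \<in> Obj B"
    and "\<And>f. f \<in> Arr A \<Longrightarrow> fmap F f \<in> Arr B \<and> Dom B (fmap F f) = fobj F (Dom A f)
                               \<and> Cod B (fmap F f) = fobj F (Cod A f)"
    and "\<And>x. x \<in> Obj A \<Longrightarrow> fmap F (Ident A x) = Ident B (fobj F x)"
    and "\<And>f g. \<lbrakk>f \<in> Arr A; g \<in> Arr A; Cod A f = Dom A g\<rbrakk>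
          \<Longrightarrow> fmap F (Comp A g f) = Comp B (fmap F g) (fmap F f)"
  shows "cat_functor A B F"
  using assms
  by (auto simp: cat_functor_def cat_functor_axioms_def Hom_def PiE_def)

text \<open>Both functors are \<open>undefined\<close> off \<open>A\<close>, so agreement on objects
  and arrows of \<open>A\<close> already gives equality of the records.\<close>

lemma functor_eqI:
  assumes "cat_functor A B F" "cat_functor A B' F'"
    and "\<And>x. x \<in> Obj A \<Longrightarrow> fobj F x = fobj F' x"
    and "\<And>f. f \<in> Arr A \<Longrightarrow> fmap F f = fmap F' f"
  shows "F = F'"
proof (rule func.equality)
  show "fobj F = fobj F'"
    using cat_functor.fobj_maps[OF assms(1)] cat_functor.fobj_maps[OF assms(2)] assms(3)
    by (auto intro!: extensionalityI[of _ "Obj A"] simp: PiE_def)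
  show "fmap F = fmap F'"
    using cat_functor.fmap_maps[OF assms(1)] cat_functor.fmap_maps[OF assms(2)] assms(4)
    by (auto intro!: extensionalityI[of _ "Arr A"] simp: PiE_def)
qed simp

lemma comp_func_apply:
  "x \<in> Obj A \<Longrightarrow> fobj (comp_func A K F) x = fobj K (fobj F x)"
  "f \<in> Arr A \<Longrightarrow> fmap (comp_func A K F) f = fmap K (fmap F f)"
  by (simp_all add: comp_func_def compose_def)

lemma comp_func_extensional:
  "fobj (comp_func A K F) \<in> extensional (Obj A)" "fmap (comp_func A K F) \<in> extensional (Arr A)"
  by (simp_all add: comp_func_def)

lemma id_func_apply:
  "x \<in> Obj A \<Longrightarrow> fobj (id_func A) x = x"
  "f \<in> Arr A \<Longrightarrow> fmap (id_func A) f = f"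
  by (simp_all add: id_func_def)

lemma cat_functor_comp:
  assumes "cat_functor A B F" "cat_functor B C K"
  shows "cat_functor A C (comp_func A K F)"
proof -
  interpret F: cat_functor A B F by fact
  interpret K: cat_functor B C K by fact
  show ?thesis
    by (rule cat_functorI)
      (auto simp: comp_func_apply F.source.arr_simps F.functor_simps K.functor_simps
        F.source.category_axioms K.target.category_axioms comp_func_extensional)
qed

section \<open>Natural transformations\<close>

lemma natural_transformationI:
  assumes "cat_functor A B (nt_dom \<eta>)" "cat_functor A B (nt_cod \<eta>)"
    and "nt_at \<eta> \<in> extensional (Obj A)"
    and "\<And>x. x \<in> Obj A \<Longrightarrow> nt_at \<eta> x \<in> Arr B \<and> Dom B (nt_at \<eta> x) = fobj (nt_dom \<eta>) x
                              \<and> Cod B (nt_at \<eta> x) = fobj (nt_cod \<eta>) x"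
    and "\<And>f. f \<in> Arr A \<Longrightarrow> Comp B (nt_at \<eta> (Cod A f)) (fmap (nt_dom \<eta>) f)
                               = Comp B (fmap (nt_cod \<eta>) f) (nt_at \<eta> (Dom A f))"
  shows "natural_transformation A B \<eta>"
  using assms
  by (auto simp: natural_transformation_def natural_transformation_axioms_def Hom_def)

context natural_transformation
begin

lemma nt_arr:
  assumes "x \<in> Obj A"
  shows "nt_at \<eta> x \<in> Arr B" "Dom B (nt_at \<eta> x) = fobj (nt_dom \<eta>) x"
    "Cod B (nt_at \<eta> x) = fobj (nt_cod \<eta>) x"
  using HomD[OF nt_hom[OF assms]] by auto

lemma nt_natural_arr:
  "f \<in> Arr A \<Longrightarrow> Comp B (nt_at \<eta> (Cod A f)) (fmap (nt_dom \<eta>) f)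
                  = Comp B (fmap (nt_cod \<eta>) f) (nt_at \<eta> (Dom A f))"
  by (rule nt_natural) (auto intro: HomI)

end

lemma natural_transformation_eqI:
  assumes "natural_transformation A B \<eta>" "natural_transformation A B' \<eta>'"
    and "nt_dom \<eta> = nt_dom \<eta>'" "nt_cod \<eta> = nt_cod \<eta>'"
    and "\<And>x. x \<in> Obj A \<Longrightarrow> nt_at \<eta> x = nt_at \<eta>' x"
  shows "\<eta> = \<eta>'"
proof (rule nat_trans.equality)
  show "nt_at \<eta> = nt_at \<eta>'"
    using natural_transformation.nt_ext[OF assms(1)] natural_transformation.nt_ext[OF assms(2)]
      assms(5)
    by (auto intro!: extensionalityI[of _ "Obj A"])
qed (use assms in simp_all)

lemma id_nt_simps:
  "nt_dom (id_nt A B F) = F" "nt_cod (id_nt A B F) = F"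
  "x \<in> Obj A \<Longrightarrow> nt_at (id_nt A B F) x = Ident B (fobj F x)"
  by (simp_all add: id_nt_def)

lemma comp_nt_simps:
  "nt_dom (comp_nt A B \<mu> \<eta>) = nt_dom \<eta>" "nt_cod (comp_nt A B \<mu> \<eta>) = nt_cod \<mu>"
  "x \<in> Obj A \<Longrightarrow> nt_at (comp_nt A B \<mu> \<eta>) x = Comp B (nt_at \<mu> x) (nt_at \<eta> x)"
  by (simp_all add: comp_nt_def)

lemma natural_transformation_id:
  assumes "cat_functor A B F"
  shows "natural_transformation A B (id_nt A B F)"
proof -
  interpret cat_functor A B F by fact
  show ?thesis
    by (rule natural_transformationI)
      (use assms in \<open>auto simp: id_nt_def source.arr_simps target.arr_simps functor_simps\<close>)
qed

lemma natural_transformation_comp: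
  assumes "natural_transformation A B \<eta>" "natural_transformation A B \<mu>"
    and eq: "nt_cod \<eta> = nt_dom \<mu>"
  shows "natural_transformation A B (comp_nt A B \<mu> \<eta>)"
proof -
  interpret e: natural_transformation A B \<eta> by fact
  interpret m: natural_transformation A B \<mu> by fact
  show ?thesis
  proof (rule natural_transformationI, unfold comp_nt_def nat_trans.simps)
    show "cat_functor A B (nt_dom \<eta>)" "cat_functor A B (nt_cod \<mu>)"
      by unfold_locales
    fix f assume f: "f \<in> Arr A"
    let ?d = "nt_at \<eta> (Dom A f)" and ?c = "nt_at \<mu> (Cod A f)"
    have o: "Dom A f \<in> Obj A" "Cod A f \<in> Obj A"
      using f by (auto simp: e.dom.source.arr_simps)
    note s = e.dom.target.arr_simps e.dom.functor_simps m.cod.functor_simps m.dom.functor_simps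
      e.nt_arr m.nt_arr eq f o
    \<comment> \<open>The two naturality squares are pasted along the middle functor
      \<open>nt_cod \<eta> = nt_dom \<mu>\<close>: first the square of \<eta>, then that of
      \<mu>.\<close>
    have "Comp B (Comp B ?c (nt_at \<eta> (Cod A f))) (fmap (nt_dom \<eta>) f)
        = Comp B ?c (Comp B (fmap (nt_cod \<eta>) f) ?d)"
      using e.nt_natural_arr[OF f] by (simp add: s)
    also have "\<dots> = Comp B (Comp B ?c (fmap (nt_dom \<mu>) f)) ?d"
      by (simp add: s)
    also have "\<dots> = Comp B (fmap (nt_cod \<mu>) f) (Comp B (nt_at \<mu> (Dom A f)) ?d)"
      using m.nt_natural_arr[OF f] by (simp add: s)
    finally show "Comp B ((\<lambda>x\<in>Obj A. Comp B (nt_at \<mu> x) (nt_at \<eta> x)) (Cod A f)) (fmap (nt_dom \<eta>) f)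
      = Comp B (fmap (nt_cod \<mu>) f) ((\<lambda>x\<in>Obj A. Comp B (nt_at \<mu> x) (nt_at \<eta> x)) (Dom A f))"
      using o by simp
  qed (auto simp: e.dom.target.arr_simps e.nt_arr m.nt_arr eq)
qed

text \<open>Functors preserve commuting squares, so applying \<open>K\<close> to the naturality
  square of \<eta> gives the new one.\<close>

lemma natural_transformation_whisker:
  assumes "natural_transformation A B \<eta>" "cat_functor B B' K"
  shows "natural_transformation A B' (whisker A K \<eta>)"
proof -
  interpret e: natural_transformation A B \<eta> by fact
  interpret K: cat_functor B B' K by fact
  show ?thesis
  proof (rule natural_transformationI, unfold whisker_def nat_trans.simps)
    show "cat_functor A B' (comp_func A K (nt_dom \<eta>))" "cat_functor A B' (comp_func A K (nt_cod \<eta>))"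
      by (rule cat_functor_comp; unfold_locales)+
    fix f assume f: "f \<in> Arr A"
    then have o: "Dom A f \<in> Obj A" "Cod A f \<in> Obj A"
      by (auto simp: e.dom.source.arr_simps)
    have "fmap K (Comp B (nt_at \<eta> (Cod A f)) (fmap (nt_dom \<eta>) f))
        = fmap K (Comp B (fmap (nt_cod \<eta>) f) (nt_at \<eta> (Dom A f)))"
      using f by (simp add: e.nt_natural_arr)
    then show "Comp B' ((\<lambda>x\<in>Obj A. fmap K (nt_at \<eta> x)) (Cod A f)) (fmap (comp_func A K (nt_dom \<eta>)) f)
      = Comp B' (fmap (comp_func A K (nt_cod \<eta>)) f) ((\<lambda>x\<in>Obj A. fmap K (nt_at \<eta> x)) (Dom A f))"
      using f o by (simp add: comp_func_apply K.functor_simps e.nt_arr e.dom.functor_simps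
          e.cod.functor_simps)
  qed (auto simp: K.functor_simps e.nt_arr comp_func_apply)
qed

section \<open>Functor categories\<close>

lemma functor_cat_simps [simp]:
  "Obj (functor_cat A B) = {F. cat_functor A B F}"
  "Arr (functor_cat A B) = {\<eta>. natural_transformation A B \<eta>}"
  "Dom (functor_cat A B) = nt_dom" "Cod (functor_cat A B) = nt_cod"
  "Ident (functor_cat A B) = id_nt A B" "Comp (functor_cat A B) = comp_nt A B"
  by (simp_all add: functor_cat_def)

lemma categoryI:
  assumes "\<And>f. f \<in> Arr C \<Longrightarrow> Dom C f \<in> Obj C" "\<And>f. f \<in> Arr C \<Longrightarrow> Cod C f \<in> Obj C"
    and "\<And>x. x \<in> Obj C \<Longrightarrow> Ident C x \<in> Arr C \<and> Dom C (Ident C x) = x \<and> Cod C (Ident C x) = x"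
    and "\<And>f g. \<lbrakk>f \<in> Arr C; g \<in> Arr C; Cod C f = Dom C g\<rbrakk> \<Longrightarrow>
          Comp C g f \<in> Arr C \<and> Dom C (Comp C g f) = Dom C f \<and> Cod C (Comp C g f) = Cod C g"
    and "\<And>f. f \<in> Arr C \<Longrightarrow> Comp C (Ident C (Cod C f)) f = f"
    and "\<And>f. f \<in> Arr C \<Longrightarrow> Comp C f (Ident C (Dom C f)) = f"
    and "\<And>f g h. \<lbrakk>f \<in> Arr C; g \<in> Arr C; h \<in> Arr C; Cod C f = Dom C g; Cod C g = Dom C h\<rbrakk>
          \<Longrightarrow> Comp C (Comp C h g) f = Comp C h (Comp C g f)"
  shows "category C"
  using assms by (auto simp: category_def Hom_def)

text \<open>The laws are inherited componentwise from \<open>B\<close>; extensionality of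
  \<open>nt_at\<close> turns componentwise agreement into equality of arrows.\<close>

lemma category_functor_cat:
  assumes "category A" "category B"
  shows "category (functor_cat A B)"
proof -
  interpret A: category A by fact
  interpret B: category B by fact
  show ?thesis
  proof (rule categoryI, unfold functor_cat_simps mem_Collect_eq)
    fix \<eta> assume e: "natural_transformation A B \<eta>"
    then interpret natural_transformation A B \<eta> .
    show "cat_functor A B (nt_dom \<eta>)" "cat_functor A B (nt_cod \<eta>)" by unfold_locales
    show "comp_nt A B (id_nt A B (nt_cod \<eta>)) \<eta> = \<eta>"
      by (rule natural_transformation_eqI[where B = B and B' = B],
          rule natural_transformation_comp)
        (auto simp: comp_nt_simps id_nt_simps e B.arr_simps nt_arr natural_transformation_id
          cod.cat_functor_axioms)
    show "comp_nt A B \<eta> (id_nt A B (nt_dom \<eta>)) = \<eta>"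
      by (rule natural_transformation_eqI[where B = B and B' = B],
          rule natural_transformation_comp)
        (auto simp: comp_nt_simps id_nt_simps e B.arr_simps nt_arr natural_transformation_id
          dom.cat_functor_axioms)
  next
    fix F assume "cat_functor A B F"
    then show "natural_transformation A B (id_nt A B F) \<and> nt_dom (id_nt A B F) = F \<and> nt_cod (id_nt A B F) = F"
      by (simp add: natural_transformation_id) (simp add: id_nt_def)
  next
    fix \<eta> \<mu> assume "natural_transformation A B \<eta>" "natural_transformation A B \<mu>" "nt_cod \<eta> = nt_dom \<mu>"
    then show "natural_transformation A B (comp_nt A B \<mu> \<eta>) \<and>
        nt_dom (comp_nt A B \<mu> \<eta>) = nt_dom \<eta> \<and> nt_cod (comp_nt A B \<mu> \<eta>) = nt_cod \<mu>"
      by (simp add: natural_transformation_comp) (simp add: comp_nt_def)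
  next
    fix \<eta> \<mu> \<nu>
    assume a: "natural_transformation A B \<eta>" "natural_transformation A B \<mu>" "natural_transformation A B \<nu>"
      and eq: "nt_cod \<eta> = nt_dom \<mu>" "nt_cod \<mu> = nt_dom \<nu>"
    interpret e: natural_transformation A B \<eta> by fact
    interpret m: natural_transformation A B \<mu> by fact
    interpret n: natural_transformation A B \<nu> by fact
    show "comp_nt A B (comp_nt A B \<nu> \<mu>) \<eta> = comp_nt A B \<nu> (comp_nt A B \<mu> \<eta>)"
      by (auto simp: comp_nt_def B.arr_simps e.nt_arr m.nt_arr n.nt_arr eq)
  qed
qed

text \<open>Transport of structure: \<open>\<Phi> f = a (Cod f) \<circ> K f \<circ> (a (Dom f))\<inverse>\<close>.\<close>

lemma functor_transport:
  assumes "cat_functor A B K"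
    and a_ext: "a \<in> extensional (Obj A)"
    and a_dom: "\<And>x. x \<in> Obj A \<Longrightarrow> Dom B (a x) = fobj K x"
    and a_iso: "\<And>x. x \<in> Obj A \<Longrightarrow> iso_arr B (a x)"
  shows "\<exists>\<Phi>. natural_isomorphism A B \<lparr>nt_dom = K, nt_cod = \<Phi>, nt_at = a\<rparr>"
proof -
  interpret K: cat_functor A B K by fact
  \<comment> \<open>An inverse \<open>b x\<close> of every component \<open>a x\<close> is
    chosen.\<close>
  have "\<exists>b. \<forall>x \<in> Obj A. b x \<in> Hom B (Cod B (a x)) (Dom B (a x)) \<and>
      Comp B (b x) (a x) = Ident B (Dom B (a x)) \<and> Comp B (a x) (b x) = Ident B (Cod B (a x))"
    using a_iso unfolding iso_arr_def by (intro bchoice) blast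
  then obtain b where b: "\<And>x. x \<in> Obj A \<Longrightarrow> b x \<in> Arr B"
      "\<And>x. x \<in> Obj A \<Longrightarrow> Dom B (b x) = Cod B (a x)"
      "\<And>x. x \<in> Obj A \<Longrightarrow> Cod B (b x) = fobj K x"
      "\<And>x. x \<in> Obj A \<Longrightarrow> Comp B (b x) (a x) = Ident B (fobj K x)"
      "\<And>x. x \<in> Obj A \<Longrightarrow> Comp B (a x) (b x) = Ident B (Cod B (a x))"
    by (auto simp: Hom_def a_dom)
  have a: "a x \<in> Arr B" if "x \<in> Obj A" for x
    using a_iso[OF that] by (simp add: iso_arr_def)
  \<comment> \<open>With composites nested to the right, \<open>b x\<close> meets \<open>a x\<close>
    only inside a longer composite, so the cancellation is stated with a tail \<open>k\<close>. It
    removes the inner pair when \<Phi> is checked on a composite.\<close>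
  have ba: "Comp B (b x) (Comp B (a x) k) = k" if "x \<in> Obj A" "k \<in> Arr B" "Cod B k = fobj K x" for x k
    using that by (simp add: K.target.arr_comp_assoc[symmetric] a b a_dom K.target.comp_ident_left)
  define P where "P = (\<lambda>f. Comp B (a (Cod A f)) (Comp B (fmap K f) (b (Dom A f))))"
  \<comment> \<open>On objects there is no choice: \<Phi> must send \<open>x\<close> to the codomain
    of \<open>a x\<close>.\<close>
  define \<Phi> where "\<Phi> = \<lparr>fobj = (\<lambda>x \<in> Obj A. Cod B (a x)), fmap = (\<lambda>f \<in> Arr A. P f)\<rparr>"
  note s = K.source.arr_simps K.target.arr_simps K.functor_simps a b a_dom
  have \<Phi>: "cat_functor A B \<Phi>"
    by (rule cat_functorI) (auto simp: \<Phi>_def P_def s ba K.source.category_axioms K.target.category_axioms)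
  have "natural_transformation A B \<lparr>nt_dom = K, nt_cod = \<Phi>, nt_at = a\<rparr>"
    by (rule natural_transformationI)
      (use \<Phi> assms in \<open>auto simp: \<Phi>_def P_def s\<close>)
  then have "natural_isomorphism A B \<lparr>nt_dom = K, nt_cod = \<Phi>, nt_at = a\<rparr>"
    by (simp add: natural_isomorphism_def natural_isomorphism_axioms_def a_iso)
  then show ?thesis ..
qed

text \<open>The componentwise inverses are automatically natural, so they form an inverse arrow in
  the functor category. This is what allows a second transport, whose target is itself a functor
  category.\<close>

lemma natural_isomorphism_iso_arr:
  assumes "natural_isomorphism A B \<eta>"
  shows "iso_arr (functor_cat A B) \<eta>"
proof -
  interpret natural_isomorphism A B \<eta> by fact
  note s = dom.source.arr_simps dom.target.arr_simps dom.functor_simps cod.functor_simps nt_arr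
  have "\<exists>b. \<forall>x \<in> Obj A. b x \<in> Hom B (Cod B (nt_at \<eta> x)) (Dom B (nt_at \<eta> x)) \<and>
      Comp B (b x) (nt_at \<eta> x) = Ident B (Dom B (nt_at \<eta> x)) \<and>
      Comp B (nt_at \<eta> x) (b x) = Ident B (Cod B (nt_at \<eta> x))"
    using nt_iso unfolding iso_arr_def by (intro bchoice) blast
  then obtain b where b: "\<And>x. x \<in> Obj A \<Longrightarrow> b x \<in> Arr B"
      "\<And>x. x \<in> Obj A \<Longrightarrow> Dom B (b x) = fobj (nt_cod \<eta>) x"
      "\<And>x. x \<in> Obj A \<Longrightarrow> Cod B (b x) = fobj (nt_dom \<eta>) x"
      "\<And>x. x \<in> Obj A \<Longrightarrow> Comp B (b x) (nt_at \<eta> x) = Ident B (fobj (nt_dom \<eta>) x)"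
      "\<And>x. x \<in> Obj A \<Longrightarrow> Comp B (nt_at \<eta> x) (b x) = Ident B (fobj (nt_cod \<eta>) x)"
    by (auto simp: Hom_def nt_arr)
  define \<beta> where "\<beta> = \<lparr>nt_dom = nt_cod \<eta>, nt_cod = nt_dom \<eta>, nt_at = restrict b (Obj A)\<rparr>"
  have \<beta>: "natural_transformation A B \<beta>"
  proof (rule natural_transformationI)
    fix f assume f: "f \<in> Arr A"
    let ?x = "Dom A f" and ?y = "Cod A f"
    have o: "?x \<in> Obj A" "?y \<in> Obj A"
      using f by (auto simp: s)
    \<comment> \<open>The identity \<open>nt_at \<eta> ?x\<close> after \<open>b ?x\<close> is
      inserted on the right; naturality of \<eta> then moves \<eta> to the left, where
      \<open>b ?y\<close> cancels it.\<close>
    have "Comp B (b ?y) (fmap (nt_cod \<eta>) f) = Comp B (b ?y) (Comp B (Comp B (fmap (nt_cod \<eta>) f) (nt_at \<eta> ?x)) (b ?x))"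
      using f o by (simp add: s b)
    \<comment> \<open>Only the typing facts \<open>b(1-3)\<close> are given to the simplifier: the
      inverse laws would cancel the pair on the right-hand side before the two sides are
      matched.\<close>
    also have "\<dots> = Comp B (Comp B (b ?y) (nt_at \<eta> ?y)) (Comp B (fmap (nt_dom \<eta>) f) (b ?x))"
      unfolding nt_natural_arr[OF f, symmetric] using f o by (simp add: s b(1-3))
    also have "\<dots> = Comp B (fmap (nt_dom \<eta>) f) (b ?x)"
      using f o by (simp add: s b)
    finally show "Comp B (nt_at \<beta> ?y) (fmap (nt_dom \<beta>) f) = Comp B (fmap (nt_cod \<beta>) f) (nt_at \<beta> ?x)"
      using o by (simp add: \<beta>_def)
  qed (auto simp: \<beta>_def b dom.cat_functor_axioms cod.cat_functor_axioms)
  show ?thesis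
    unfolding iso_arr_def Hom_def functor_cat_simps mem_Collect_eq
    by (intro conjI bexI[of _ \<beta>] CollectI)
      (auto simp: \<beta> natural_transformation_axioms, auto simp: \<beta>_def comp_nt_def id_nt_def b)
qed

section \<open>G-categories\<close>

context G_category
begin

lemma act_simps:
  assumes "g \<in> carrier G"
  shows "x \<in> Obj C \<Longrightarrow> fobj (act C g) x \<in> Obj C"
    "f \<in> Arr C \<Longrightarrow> fmap (act C g) f \<in> Arr C"
    "f \<in> Arr C \<Longrightarrow> Dom C (fmap (act C g) f) = fobj (act C g) (Dom C f)"
    "f \<in> Arr C \<Longrightarrow> Cod C (fmap (act C g) f) = fobj (act C g) (Cod C f)"
    "\<lbrakk>f \<in> Arr C; f' \<in> Arr C; Cod C f = Dom C f'\<rbrakk>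
      \<Longrightarrow> fmap (act C g) (Comp C f' f) = Comp C (fmap (act C g) f') (fmap (act C g) f)"
    "x \<in> Obj C \<Longrightarrow> fmap (act C g) (Ident C x) = Ident C (fobj (act C g) x)"
  using act_functor[OF assms] by (simp_all add: cat_functor.functor_simps)

lemma act_one_apply:
  "x \<in> Obj C \<Longrightarrow> fobj (act C \<one>) x = x"
  "f \<in> Arr C \<Longrightarrow> fmap (act C \<one>) f = f"
  by (simp_all add: act_one id_func_apply)

lemma act_act:
  assumes "g \<in> carrier G" "h \<in> carrier G"
  shows "x \<in> Obj C \<Longrightarrow> fobj (act C g) (fobj (act C h) x) = fobj (act C (g \<otimes> h)) x"
    "f \<in> Arr C \<Longrightarrow> fmap (act C g) (fmap (act C h) f) = fmap (act C (g \<otimes> h)) f"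
  using act_mult[OF assms] by (metis comp_func_apply(1), metis comp_func_apply(2))

end

lemma functor_gcat_simps [simp]:
  "Obj (functor_gcat G A C) = {F. cat_functor A C F}"
  "Arr (functor_gcat G A C) = {\<eta>. natural_transformation A C \<eta>}"
  "Dom (functor_gcat G A C) = nt_dom" "Cod (functor_gcat G A C) = nt_cod"
  "Ident (functor_gcat G A C) = id_nt A C" "Comp (functor_gcat G A C) = comp_nt A C"
  "act (functor_gcat G A C) g = \<lparr>fobj = restrict (conj_func G A C g) {F. cat_functor A C F},
     fmap = restrict (conj_nt G A C g) {\<eta>. natural_transformation A C \<eta>}\<rparr>"
  by (simp_all add: functor_gcat_def functor_cat_def cat.defs)

text \<open>\<open>functor_gcat\<close> adds only the \<open>act\<close> field to
  \<open>functor_cat\<close>, and \<open>category\<close> reads just the six base fields.\<close>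

lemma category_functor_gcat:
  assumes "category A" "category B"
  shows "category (functor_gcat G A B)"
  using category_functor_cat[OF assms] by (simp add: category_def Hom_def)

lemma iso_arr_functor_gcat:
  "iso_arr (functor_gcat G A B) \<eta> \<longleftrightarrow> iso_arr (functor_cat A B) \<eta>"
  by (simp add: iso_arr_def Hom_def)

section \<open>The translation category\<close>

lemma translation_cat_simps [simp]:
  "Obj (translation_cat G) = carrier G" "Arr (translation_cat G) = carrier G \<times> carrier G"
  "Dom (translation_cat G) = fst" "Cod (translation_cat G) = snd"
  "Ident (translation_cat G) x = (x, x)" "Comp (translation_cat G) v u = (fst u, snd v)"
  "act (translation_cat G) g = \<lparr>fobj = (\<lambda>x \<in> carrier G. g \<otimes>\<^bsub>G\<^esub> x),
     fmap = (\<lambda>(x, y) \<in> carrier G \<times> carrier G. (g \<otimes>\<^bsub>G\<^esub> x, g \<otimes>\<^bsub>G\<^esub> y))\<rparr>"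
  by (simp_all add: translation_cat_def)

lemma category_translation_cat: "category (translation_cat G)"
  by (rule categoryI) auto

lemma G_category_translation_cat:
  assumes "group G"
  shows "G_category G (translation_cat G)"
proof -
  interpret group G by fact
  interpret T: category "translation_cat G" by (rule category_translation_cat)
  show ?thesis
  proof (intro G_category.intro G_category_axioms.intro group_axioms T.category_axioms)
    fix g assume g: "g \<in> carrier G"
    show "cat_functor (translation_cat G) (translation_cat G) (act (translation_cat G) g)"
      by (rule cat_functorI) (use g in \<open>auto simp: T.category_axioms\<close>)
    fix h assume "h \<in> carrier G"
    with g show "comp_func (translation_cat G) (act (translation_cat G) g) (act (translation_cat G) h)
        = act (translation_cat G) (g \<otimes>\<^bsub>G\<^esub> h)"
      by (auto simp: comp_func_def compose_def restrict_def m_assoc fun_eq_iff)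
  next
    show "act (translation_cat G) \<one>\<^bsub>G\<^esub> = id_func (translation_cat G)"
      by (auto simp: id_func_def restrict_def fun_eq_iff)
  qed
qed

section \<open>The conjugation action on functor categories\<close>

locale two_G_categories = A: G_category G A + C: G_category G C
  for G :: "('g, 'x) monoid_scheme" (structure)
    and A :: "('o1, 'm1, 'g, 'y) gcat_scheme" and C :: "('o2, 'm2, 'g, 'z) gcat_scheme"
begin

lemma cat_functor_conj:
  assumes "g \<in> carrier G" "cat_functor A C F"
  shows "cat_functor A C (conj_func G A C g F)"
  unfolding conj_func_def using assms
  by (intro cat_functor_comp[where B = C] cat_functor_comp[where B = A] C.act_functor A.act_functor) auto

lemma conj_func_apply:
  assumes "g \<in> carrier G"
  shows "x \<in> Obj A \<Longrightarrow> fobj (conj_func G A C g F) x = fobj (act C g) (fobj F (fobj (act A (inv g)) x))"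
    "f \<in> Arr A \<Longrightarrow> fmap (conj_func G A C g F) f = fmap (act C g) (fmap F (fmap (act A (inv g)) f))"
  using assms by (simp_all add: conj_func_def comp_func_apply)

lemma conj_nt_simps:
  "nt_dom (conj_nt G A C g \<eta>) = conj_func G A C g (nt_dom \<eta>)"
  "nt_cod (conj_nt G A C g \<eta>) = conj_func G A C g (nt_cod \<eta>)"
  "x \<in> Obj A \<Longrightarrow> nt_at (conj_nt G A C g \<eta>) x = fmap (act C g) (nt_at \<eta> (fobj (act A (inv g)) x))"
  by (simp_all add: conj_nt_def)

text \<open>The naturality square at \<open>f\<close> is the image under \<open>act C g\<close> of
  the square of \<eta> at the arrow \<open>inv g\<close> applied to \<open>f\<close>.\<close>

lemma natural_transformation_conj:
  assumes g: "g \<in> carrier G" and "natural_transformation A C \<eta>"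
  shows "natural_transformation A C (conj_nt G A C g \<eta>)"
proof -
  interpret natural_transformation A C \<eta> by fact
  note s = conj_nt_simps conj_func_apply A.act_simps C.act_simps nt_arr A.arr_simps C.arr_simps
    dom.functor_simps cod.functor_simps
  show ?thesis
  proof (rule natural_transformationI)
    show "nt_at (conj_nt G A C g \<eta>) \<in> extensional (Obj A)"
      by (simp add: conj_nt_def)
    fix f assume f: "f \<in> Arr A"
    then have k: "fmap (act A (inv g)) f \<in> Arr A" (is "?k \<in> _")
      using g by (simp add: s)
    have "fmap (act C g) (Comp C (nt_at \<eta> (Cod A ?k)) (fmap (nt_dom \<eta>) ?k))
        = fmap (act C g) (Comp C (fmap (nt_cod \<eta>) ?k) (nt_at \<eta> (Dom A ?k)))"
      by (simp add: nt_natural_arr[OF k])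
    then show "Comp C (nt_at (conj_nt G A C g \<eta>) (Cod A f)) (fmap (nt_dom (conj_nt G A C g \<eta>)) f) =
         Comp C (fmap (nt_cod (conj_nt G A C g \<eta>)) f) (nt_at (conj_nt G A C g \<eta>) (Dom A f))"
      using f g by (simp add: s)
  qed (use g in \<open>auto simp: s cat_functor_conj dom.cat_functor_axioms cod.cat_functor_axioms\<close>)
qed

lemma conj_func_one:
  assumes "cat_functor A C F"
  shows "conj_func G A C \<one> F = F"
proof -
  interpret cat_functor A C F by fact
  show ?thesis
    by (rule functor_eqI[where A = A and B = C and B' = C])
      (auto simp: cat_functor_conj assms conj_func_apply A.act_one_apply C.act_one_apply functor_simps)
qed

lemma conj_nt_one:
  assumes "natural_transformation A C \<eta>"
  shows "conj_nt G A C \<one> \<eta> = \<eta>"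
proof -
  interpret natural_transformation A C \<eta> by fact
  show ?thesis
    by (rule natural_transformation_eqI[where A = A and B = C and B' = C])
      (auto simp: natural_transformation_conj assms conj_nt_simps conj_func_one A.act_one_apply
        C.act_one_apply nt_arr dom.cat_functor_axioms cod.cat_functor_axioms)
qed

text \<open>On the source the inverses act in the order \<open>inv h\<close> after
  \<open>inv g\<close>, which is the action of \<open>inv (g \<otimes> h)\<close>; on the target
  \<open>g\<close> acts after \<open>h\<close>.\<close>

lemma conj_func_mult:
  assumes g: "g \<in> carrier G" and h: "h \<in> carrier G" and "cat_functor A C F"
  shows "conj_func G A C g (conj_func G A C h F) = conj_func G A C (g \<otimes> h) F"
proof -
  interpret cat_functor A C F by fact
  show ?thesis
    by (rule functor_eqI[where A = A and B = C and B' = C])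
      (use assms in \<open>auto simp: cat_functor_conj conj_func_apply A.act_act C.act_act
        functor_simps A.act_simps A.inv_mult_group\<close>)
qed

lemma conj_nt_mult:
  assumes g: "g \<in> carrier G" and h: "h \<in> carrier G" and "natural_transformation A C \<eta>"
  shows "conj_nt G A C g (conj_nt G A C h \<eta>) = conj_nt G A C (g \<otimes> h) \<eta>"
proof -
  interpret natural_transformation A C \<eta> by fact
  show ?thesis
    by (rule natural_transformation_eqI[where A = A and B = C and B' = C])
      (use assms in \<open>auto simp: natural_transformation_conj conj_nt_simps conj_func_mult A.act_act
        C.act_act nt_arr A.act_simps A.inv_mult_group dom.cat_functor_axioms cod.cat_functor_axioms\<close>)
qed

lemma conj_nt_id:
  assumes g: "g \<in> carrier G" and "cat_functor A C F"
  shows "conj_nt G A C g (id_nt A C F) = id_nt A C (conj_func G A C g F)"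
proof -
  interpret cat_functor A C F by fact
  show ?thesis
    by (rule natural_transformation_eqI[where A = A and B = C and B' = C])
      (use assms in \<open>simp_all add: natural_transformation_conj natural_transformation_id
        cat_functor_conj conj_nt_simps id_nt_simps conj_func_apply A.act_simps C.act_simps functor_simps\<close>)
qed

lemma conj_nt_comp:
  assumes g: "g \<in> carrier G" and "natural_transformation A C \<eta>" "natural_transformation A C \<mu>"
    and eq: "nt_cod \<eta> = nt_dom \<mu>"
  shows "conj_nt G A C g (comp_nt A C \<mu> \<eta>) = comp_nt A C (conj_nt G A C g \<mu>) (conj_nt G A C g \<eta>)"
proof -
  interpret e: natural_transformation A C \<eta> by fact
  interpret m: natural_transformation A C \<mu> by fact
  show ?thesis
    by (rule natural_transformation_eqI[where A = A and B = C and B' = C])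
      (use assms in \<open>simp_all add: natural_transformation_conj natural_transformation_comp
        conj_nt_simps comp_nt_simps A.act_simps C.act_simps e.nt_arr m.nt_arr\<close>)
qed

text \<open>The preceding lemmas on \<open>conj_func\<close> and \<open>conj_nt\<close> are the
  functor and action laws. Restricting the action to functors and transformations makes these laws
  hold as equalities of records.\<close>

lemma G_category_functor_gcat: "G_category G (functor_gcat G A C)"
proof -
  have c: "category (functor_gcat G A C)"
    by (rule category_functor_gcat) unfold_locales
  then interpret F: category "functor_gcat G A C" .
  show ?thesis
  proof (intro G_category.intro G_category_axioms.intro c A.group_axioms)
    show "act (functor_gcat G A C) \<one> = id_func (functor_gcat G A C)"
      by (auto simp: id_func_def restrict_def fun_eq_iff conj_func_one conj_nt_one)
    fix g assume g: "g \<in> carrier G"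
    show "cat_functor (functor_gcat G A C) (functor_gcat G A C) (act (functor_gcat G A C) g)"
      by (rule cat_functorI)
        (use F.arr_simps g in \<open>auto simp: c cat_functor_conj natural_transformation_conj
          conj_nt_id conj_nt_comp conj_nt_simps\<close>)
    fix h assume h: "h \<in> carrier G"
    show "comp_func (functor_gcat G A C) (act (functor_gcat G A C) g) (act (functor_gcat G A C) h)
        = act (functor_gcat G A C) (g \<otimes> h)"
      using g h by (auto simp: comp_func_def compose_def restrict_def fun_eq_iff cat_functor_conj
          natural_transformation_conj conj_func_mult conj_nt_mult)
  qed
qed

end

text \<open>\<open>cat_functor\<close> does not see the \<open>act\<close> fields, so
  \<open>G\<close> and \<open>G'\<close> are independent here.\<close>

lemma cat_functor_postcomp:
  assumes "category A" "cat_functor B B' K"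
  shows "cat_functor (functor_gcat G A B) (functor_gcat G' A B') (postcomp A B K)"
proof -
  interpret K: cat_functor B B' K by fact
  have c: "category (functor_gcat G A B)" "category (functor_gcat G' A B')"
    by (simp_all add: category_functor_gcat assms(1) K.source.category_axioms K.target.category_axioms)
  interpret X: category "functor_gcat G A B" by fact
  show ?thesis
  proof (rule cat_functorI[OF c])
    fix F assume "F \<in> Obj (functor_gcat G A B)"
    then interpret F: cat_functor A B F by simp
    show "fmap (postcomp A B K) (Ident (functor_gcat G A B) F)
        = Ident (functor_gcat G' A B') (fobj (postcomp A B K) F)"
      by (auto simp: postcomp_def F.cat_functor_axioms natural_transformation_id)
        (auto simp: whisker_def id_nt_def comp_func_apply K.functor_simps F.functor_simps)
  next
    fix \<eta> \<mu> assume a: "\<eta> \<in> Arr (functor_gcat G A B)" "\<mu> \<in> Arr (functor_gcat G A B)"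
      and eq: "Cod (functor_gcat G A B) \<eta> = Dom (functor_gcat G A B) \<mu>"
    interpret e: natural_transformation A B \<eta> using a by simp
    interpret m: natural_transformation A B \<mu> using a by simp
    have "natural_transformation A B (comp_nt A B \<mu> \<eta>)"
      \<comment> \<open>\<open>postcomp\<close> is a restricted map: it unfolds on the composite
        only once the composite is known to be natural.\<close>
      using a eq by (simp add: natural_transformation_comp)
    moreover have "whisker A K (comp_nt A B \<mu> \<eta>) = comp_nt A B' (whisker A K \<mu>) (whisker A K \<eta>)"
      using eq by (auto simp: whisker_def comp_nt_def K.functor_simps e.nt_arr m.nt_arr)
    ultimately show "fmap (postcomp A B K) (Comp (functor_gcat G A B) \<mu> \<eta>)
        = Comp (functor_gcat G' A B') (fmap (postcomp A B K) \<mu>) (fmap (postcomp A B K) \<eta>)"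
      using a by (simp add: postcomp_def)
  next
    fix \<eta> assume "\<eta> \<in> Arr (functor_gcat G A B)"
    then show "fmap (postcomp A B K) \<eta> \<in> Arr (functor_gcat G' A B') \<and>
        Dom (functor_gcat G' A B') (fmap (postcomp A B K) \<eta>) = fobj (postcomp A B K) (Dom (functor_gcat G A B) \<eta>) \<and>
        Cod (functor_gcat G' A B') (fmap (postcomp A B K) \<eta>) = fobj (postcomp A B K) (Cod (functor_gcat G A B) \<eta>)"
      using X.dom_obj X.cod_obj assms
      by (auto simp: postcomp_def natural_transformation_whisker) (auto simp: whisker_def)
  qed (use assms in \<open>auto simp: postcomp_def cat_functor_comp\<close>)
qed

section \<open>Fixed subcategories\<close>

lemma fixed_cat_simps [simp]:
  "Obj (fixed_cat C H) = {x \<in> Obj C. \<forall>h \<in> H. fobj (act C h) x = x}"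
  "Arr (fixed_cat C H) = {f \<in> Arr C. \<forall>h \<in> H. fmap (act C h) f = f}"
  "Dom (fixed_cat C H) = Dom C" "Cod (fixed_cat C H) = Cod C"
  "Ident (fixed_cat C H) = Ident C" "Comp (fixed_cat C H) = Comp C"
  by (simp_all add: fixed_cat_def)

lemma (in G_category) category_fixed_cat:
  assumes "H \<subseteq> carrier G"
  shows "category (fixed_cat C H)"
proof -
  \<comment> \<open>Endpoints of a fixed arrow are fixed, because the action commutes with
    \<open>Dom\<close> and \<open>Cod\<close>.\<close>
  have "fobj (act C h) (Dom C f) = Dom C f" "fobj (act C h) (Cod C f) = Cod C f"
    if "f \<in> Arr C" "fmap (act C h) f = f" "h \<in> H" for f h
    using act_simps(3,4)[of h f] that assms by auto
  then show ?thesis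
    using assms by (intro categoryI) (auto simp: arr_simps subset_iff act_simps)
qed

lemma (in equivariant_functor) equivariant_apply:
  assumes "g \<in> carrier G"
  shows "x \<in> Obj C \<Longrightarrow> fobj F (fobj (act C g) x) = fobj (act D g) (fobj F x)"
    "f \<in> Arr C \<Longrightarrow> fmap F (fmap (act C g) f) = fmap (act D g) (fmap F f)"
  using equivariant[OF assms] by (metis comp_func_apply(1), metis comp_func_apply(2))

text \<open>If \<open>h\<close> fixes \<open>x\<close>, strict equivariance gives
  \<open>h F(x) = F(h x) = F(x)\<close>, and likewise for arrows. The restriction makes the functor
  \<open>undefined\<close> off the smaller source.\<close>

lemma (in equivariant_functor) cat_functor_fixed_cat:
  assumes "H \<subseteq> carrier G"
  shows "cat_functor (fixed_cat C H) (fixed_cat D H) (restrict_func (fixed_cat C H) F)"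
proof -
  interpret X: category "fixed_cat C H" by (rule source.category_fixed_cat) fact
  have e: "fobj (act D h) (fobj F x) = fobj F x"
    if "x \<in> Obj C" "\<forall>h\<in>H. fobj (act C h) x = x" "h \<in> H" for x h
    using equivariant_apply(1)[of h x] that assms by auto
  have e': "fmap (act D h) (fmap F f) = fmap F f"
    if "f \<in> Arr C" "\<forall>h\<in>H. fmap (act C h) f = f" "h \<in> H" for f h
    using equivariant_apply(2)[of h f] that assms by auto
  show ?thesis
    by (rule cat_functorI)
      (use X.dom_obj X.cod_obj X.ident_arr X.comp_arr X.category_axioms
          target.category_fixed_cat[OF assms] e e'
        in \<open>auto simp: restrict_func_def functor_simps\<close>)
qed

section \<open>The induced equivariant functor\<close>

context pseudo_equivariant_functor
begin

section \<open>The components of \<theta> and the twisting isomorphisms\<close>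

lemma theta_arr:
  assumes "g \<in> carrier G" "c \<in> Obj C"
  shows "nt_at (\<theta> g) c \<in> Arr D" "Dom D (nt_at (\<theta> g) c) = fobj \<Theta> (fobj (act C g) c)"
    "Cod D (nt_at (\<theta> g) c) = fobj (act D g) (fobj \<Theta> c)" "iso_arr D (nt_at (\<theta> g) c)"
proof -
  interpret natural_isomorphism C D "\<theta> g" using assms(1) by (rule theta_iso)
  show "nt_at (\<theta> g) c \<in> Arr D" "Dom D (nt_at (\<theta> g) c) = fobj \<Theta> (fobj (act C g) c)"
    "Cod D (nt_at (\<theta> g) c) = fobj (act D g) (fobj \<Theta> c)" "iso_arr D (nt_at (\<theta> g) c)"
    using assms by (simp_all add: nt_arr nt_iso theta_dom theta_cod comp_func_apply)
qed

lemma theta_natural: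
  assumes "g \<in> carrier G" "f \<in> Arr C"
  shows "Comp D (nt_at (\<theta> g) (Cod C f)) (fmap \<Theta> (fmap (act C g) f))
       = Comp D (fmap (act D g) (fmap \<Theta> f)) (nt_at (\<theta> g) (Dom C f))"
proof -
  interpret natural_isomorphism C D "\<theta> g" using assms(1) by (rule theta_iso)
  show ?thesis
    using nt_natural_arr[OF assms(2)] assms by (simp add: theta_dom theta_cod comp_func_apply)
qed

text \<open>These are the isomorphisms called \<open>a F x\<close> in the outline of the proof; they
  are extensional on \<open>carrier G\<close> so that \<open>twist F\<close> can serve directly as
  an \<open>nt_at\<close> field.\<close>

definition twist :: "('g, 'g \<times> 'g, 'o1, 'm1) func \<Rightarrow> 'g \<Rightarrow> 'm2" where
  "twist F = (\<lambda>x \<in> carrier G. nt_at (\<theta> x) (fobj (act C (inv x)) (fobj F x)))"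

text \<open>Strictness of the action on \<open>C\<close> matters: the domain is \<Theta> of
  \<open>x\<close> applied to \<open>inv x\<close> applied to \<open>F(x)\<close>, and this is
  literally \<Theta> of \<open>F(x)\<close>.\<close>

lemma twist_arr:
  assumes "cat_functor (translation_cat G) C F" and x: "x \<in> carrier G"
  shows "twist F x \<in> Arr D" "Dom D (twist F x) = fobj \<Theta> (fobj F x)"
    "Cod D (twist F x) = fobj (act D x) (fobj \<Theta> (fobj (act C (inv x)) (fobj F x)))"
    "iso_arr D (twist F x)"
proof -
  interpret F: cat_functor "translation_cat G" C F by fact
  have "fobj F x \<in> Obj C" using F.fobj_obj x by simp
  with x show "twist F x \<in> Arr D" "Dom D (twist F x) = fobj \<Theta> (fobj F x)"
    "Cod D (twist F x) = fobj (act D x) (fobj \<Theta> (fobj (act C (inv x)) (fobj F x)))"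
    "iso_arr D (twist F x)"
    by (simp_all add: twist_def theta_arr source.act_simps source.act_act source.act_one_apply)
qed

text \<open>The cocycle condition on \<open>\<theta>\<close>, applied to \<open>x = g (g\<inverse> x)\<close>.\<close>

lemma twist_conj:
  assumes "cat_functor (translation_cat G) C F" and g: "g \<in> carrier G" and x: "x \<in> carrier G"
  shows "twist (conj_func G (translation_cat G) C g F) x
       = Comp D (fmap (act D g) (twist F (inv g \<otimes> x))) (nt_at (\<theta> g) (fobj F (inv g \<otimes> x)))"
proof -
  interpret F: cat_functor "translation_cat G" C F by fact
  interpret two_G_categories G "translation_cat G" C
    by (intro two_G_categories.intro G_category_translation_cat) unfold_locales
  define z where "z = inv g \<otimes> x"
  have z: "z \<in> carrier G" and xz: "x = g \<otimes> z"
    using g x by (simp_all add: z_def source.m_assoc[symmetric])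
  have Fz: "fobj F z \<in> Obj C" using F.fobj_obj z by simp
  \<comment> \<open>The object at which \<open>theta_mult\<close> is used: \<open>z\<close> carries
    it to \<open>F(z)\<close>.\<close>
  define c where "c = fobj (act C (inv z)) (fobj F z)"
  have c: "c \<in> Obj C" and zc: "fobj (act C z) c = fobj F z"
    using z Fz by (simp_all add: c_def source.act_simps source.act_act source.act_one_apply)
  \<comment> \<open>Since \<open>gF\<close> sends \<open>x\<close> to \<open>g F(z)\<close>,
    applying \<open>inv x\<close> yields \<open>inv z\<close> applied to \<open>F(z)\<close>, which
    is \<open>c\<close>.\<close>
  have "inv x \<otimes> g = inv z"
    using g z by (simp add: xz source.inv_mult_group source.m_assoc)
  then have "twist (conj_func G (translation_cat G) C g F) x = nt_at (\<theta> (g \<otimes> z)) c"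
    using g x z Fz by (simp add: twist_def conj_func_apply source.act_act c_def z_def[symmetric] flip: xz)
  also have "\<dots> = Comp D (fmap (act D g) (twist F z)) (nt_at (\<theta> g) (fobj F z))"
    using g z c zc by (simp add: theta_mult twist_def c_def)
  finally show ?thesis by (simp add: z_def)
qed

text \<open>Transport is applied twice: to each \<Theta> after \<open>F\<close> along
  \<open>twist F\<close>, and then to postcomposition with \<Theta> along the resulting natural
  isomorphisms.\<close>

lemma twist_transport:
  "\<exists>\<alpha>. natural_isomorphism (Cat_tilde G C) (Cat_tilde G D) \<alpha> \<and>
    nt_dom \<alpha> = postcomp (translation_cat G) C \<Theta> \<and>
    (\<forall>F. cat_functor (translation_cat G) C F \<longrightarrow> nt_at (nt_at \<alpha> F) = twist F)"
proof -
  let ?T = "translation_cat G"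
  let ?P = "postcomp ?T C \<Theta>"
  have P: "cat_functor (Cat_tilde G C) (Cat_tilde G D) ?P"
    by (intro cat_functor_postcomp category_translation_cat) unfold_locales
  have "\<exists>\<Phi>. natural_isomorphism ?T D \<lparr>nt_dom = comp_func ?T \<Theta> F, nt_cod = \<Phi>, nt_at = twist F\<rparr>"
    if F: "cat_functor ?T C F" for F
  proof (rule functor_transport)
    show "cat_functor ?T D (comp_func ?T \<Theta> F)"
      using F by (rule cat_functor_comp) unfold_locales
    show "twist F \<in> extensional (Obj ?T)"
      by (simp add: twist_def)
  qed (use F in \<open>simp_all add: twist_arr comp_func_apply\<close>)
  then obtain \<Phi>0 where \<Phi>0: "\<And>F. cat_functor ?T C F \<Longrightarrow>
      natural_isomorphism ?T D \<lparr>nt_dom = comp_func ?T \<Theta> F, nt_cod = \<Phi>0 F, nt_at = twist F\<rparr>"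
    by metis
  define a where "a = (\<lambda>F \<in> Obj (Cat_tilde G C).
    \<lparr>nt_dom = comp_func ?T \<Theta> F, nt_cod = \<Phi>0 F, nt_at = twist F\<rparr>)"
  \<comment> \<open>The second transport. Naturality in \<open>F\<close> comes for free, since
    \<Phi> is defined on arrows so as to make \<open>a\<close> natural.\<close>
  have "\<exists>\<Phi>. natural_isomorphism (Cat_tilde G C) (Cat_tilde G D) \<lparr>nt_dom = ?P, nt_cod = \<Phi>, nt_at = a\<rparr>"
  proof (rule functor_transport[OF P])
    show "a \<in> extensional (Obj (Cat_tilde G C))"
      by (simp add: a_def)
    fix F assume "F \<in> Obj (Cat_tilde G C)"
    then show "Dom (Cat_tilde G D) (a F) = fobj ?P F" "iso_arr (Cat_tilde G D) (a F)"
      by (simp_all add: a_def postcomp_def iso_arr_functor_gcat natural_isomorphism_iso_arr \<Phi>0)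
  qed
  then obtain \<Phi> where
    "natural_isomorphism (Cat_tilde G C) (Cat_tilde G D) \<lparr>nt_dom = ?P, nt_cod = \<Phi>, nt_at = a\<rparr>" ..
  then show ?thesis
    by (intro exI conjI, assumption) (simp_all add: a_def)
qed

text \<open>The argument uses only the domain and the components of \<alpha>, never the chosen
  inverses behind its codomain.\<close>

lemma equivariant_functor_of_twist:
  assumes "natural_isomorphism (Cat_tilde G C) (Cat_tilde G D) \<alpha>"
    and dom: "nt_dom \<alpha> = postcomp (translation_cat G) C \<Theta>"
    and at: "\<And>F. cat_functor (translation_cat G) C F \<Longrightarrow> nt_at (nt_at \<alpha> F) = twist F"
  shows "equivariant_functor G (Cat_tilde G C) (Cat_tilde G D) (nt_cod \<alpha>)"
proof -
  interpret \<alpha>: natural_isomorphism "Cat_tilde G C" "Cat_tilde G D" \<alpha> by fact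
  interpret TC: two_G_categories G "translation_cat G" C
    by (intro two_G_categories.intro G_category_translation_cat) unfold_locales
  interpret TD: two_G_categories G "translation_cat G" D
    by (intro two_G_categories.intro G_category_translation_cat) unfold_locales
  interpret CT: G_category G "Cat_tilde G C" by (rule TC.G_category_functor_gcat)
  interpret DT: G_category G "Cat_tilde G D" by (rule TD.G_category_functor_gcat)
  let ?T = "translation_cat G"
  define \<Phi> where "\<Phi> = nt_cod \<alpha>"
  interpret \<Phi>: cat_functor "Cat_tilde G C" "Cat_tilde G D" \<Phi>
    unfolding \<Phi>_def by (rule \<alpha>.cod.cat_functor_axioms)
  have \<Phi>F: "cat_functor ?T D (fobj \<Phi> F)" if "cat_functor ?T C F" for F
    using \<Phi>.fobj_obj[of F] that by simp
  have \<Phi>\<eta>: "natural_transformation ?T D (fmap \<Phi> \<eta>)" "nt_dom (fmap \<Phi> \<eta>) = fobj \<Phi> (nt_dom \<eta>)"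
    "nt_cod (fmap \<Phi> \<eta>) = fobj \<Phi> (nt_cod \<eta>)" if "natural_transformation ?T C \<eta>" for \<eta>
    using \<Phi>.fmap_arr[of \<eta>] that by simp_all
  have \<alpha>F: "natural_transformation ?T D (nt_at \<alpha> F)" "nt_dom (nt_at \<alpha> F) = comp_func ?T \<Theta> F"
    "nt_cod (nt_at \<alpha> F) = fobj \<Phi> F" if "cat_functor ?T C F" for F
    using \<alpha>.nt_arr[of F] that by (simp_all add: dom postcomp_def \<Phi>_def)
  have ob: "fobj (fobj \<Phi> F) x = Cod D (twist F x)"
    if F: "cat_functor ?T C F" and "x \<in> carrier G" for F x
    using natural_transformation.nt_arr(3)[OF \<alpha>F(1)[OF F], of x] that by (simp add: \<alpha>F at)
  \<comment> \<open>Naturality in the group variable, for one fixed functor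
    \<open>F\<close>.\<close>
  have nat: "Comp D (twist F (snd p)) (fmap \<Theta> (fmap F p))
      = Comp D (fmap (fobj \<Phi> F) p) (twist F (fst p))"
    if F: "cat_functor ?T C F" and "p \<in> carrier G \<times> carrier G" for F p
    using natural_transformation.nt_natural_arr[OF \<alpha>F(1)[OF F], of p] that
    by (simp add: \<alpha>F at comp_func_apply)
  \<comment> \<open>Naturality of \<alpha> in the functor variable, evaluated at the group element
    \<open>x\<close>.\<close>
  have nat2: "Comp D (twist (nt_cod \<eta>) x) (fmap \<Theta> (nt_at \<eta> x))
      = Comp D (nt_at (fmap \<Phi> \<eta>) x) (twist (nt_dom \<eta>) x)"
    if \<eta>: "natural_transformation ?T C \<eta>" and x: "x \<in> carrier G" for \<eta> x
  proof -
    have F: "cat_functor ?T C (nt_dom \<eta>)" "cat_functor ?T C (nt_cod \<eta>)"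
      using \<eta> by (simp_all add: natural_transformation_def)
    have "nt_at (comp_nt ?T D (nt_at \<alpha> (nt_cod \<eta>)) (whisker ?T \<Theta> \<eta>)) x
        = nt_at (comp_nt ?T D (fmap \<Phi> \<eta>) (nt_at \<alpha> (nt_dom \<eta>))) x"
      using \<alpha>.nt_natural_arr[of \<eta>] \<eta> by (simp add: dom postcomp_def \<Phi>_def)
    then show ?thesis
      using x F by (simp add: comp_nt_def whisker_def at)
  qed
  have obj: "fobj \<Phi> (conj_func G ?T C g F) = conj_func G ?T D g (fobj \<Phi> F)"
    if F: "cat_functor ?T C F" and g: "g \<in> carrier G" for F g
  proof (rule functor_eqI)
    interpret F: cat_functor ?T C F by fact
    have gF: "cat_functor ?T C (conj_func G ?T C g F)"
      using F g by (simp add: TC.cat_functor_conj)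
    show c1: "cat_functor ?T D (fobj \<Phi> (conj_func G ?T C g F))"
      using gF by (rule \<Phi>F)
    show c2: "cat_functor ?T D (conj_func G ?T D g (fobj \<Phi> F))"
      using F g by (simp add: TD.cat_functor_conj \<Phi>F)
    interpret L: cat_functor ?T D "fobj \<Phi> (conj_func G ?T C g F)" by fact
    interpret R: cat_functor ?T D "conj_func G ?T D g (fobj \<Phi> F)" by fact
    interpret \<Phi>F: cat_functor ?T D "fobj \<Phi> F" using F by (rule \<Phi>F)
    have Fobj: "fobj F x \<in> Obj C" if "x \<in> carrier G" for x
      using F.fobj_obj[of x] that by simp
    note s = target.act_simps target.arr_simps functor_simps theta_arr twist_arr[OF F] Fobj
    \<comment> \<open>By \<open>ob\<close> both sides are codomains, and \<open>twist_conj\<close>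
      writes the twist of \<open>gF\<close> as a composite ending in \<open>g\<close> applied to the
      twist of \<open>F\<close>.\<close>
    show "fobj (fobj \<Phi> (conj_func G ?T C g F)) x = fobj (conj_func G ?T D g (fobj \<Phi> F)) x"
      if "x \<in> Obj ?T" for x
      using that g F gF by (simp add: ob twist_conj TD.conj_func_apply s)
    fix p assume "p \<in> Arr ?T"
    then have p: "p \<in> carrier G \<times> carrier G" by simp
    define x y where "x = fst p" and "y = snd p"
    have xy: "p = (x, y)" "x \<in> carrier G" "y \<in> carrier G"
      using p by (auto simp: x_def y_def)
    define x' y' where "x' = inv g \<otimes> x" and "y' = inv g \<otimes> y"
    have x'y': "x' \<in> carrier G" "y' \<in> carrier G"
      using xy g by (auto simp: x'_def y'_def)
    let ?q = "(x', y')" and ?gF = "conj_func G ?T C g F"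
    have q: "fmap F ?q \<in> Arr C" "Dom C (fmap F ?q) = fobj F x'" "Cod C (fmap F ?q) = fobj F y'"
      using F.fmap_arr[of ?q] x'y' by simp_all
    have r: "fmap (fobj \<Phi> F) ?q \<in> Arr D" "Dom D (fmap (fobj \<Phi> F) ?q) = Cod D (twist F x')"
      "Cod D (fmap (fobj \<Phi> F) ?q) = Cod D (twist F y')"
      using \<Phi>F.fmap_arr[of ?q] x'y' F by (simp_all add: ob)
    note s = s q r x'y' g
    have tw: "twist ?gF x = Comp D (fmap (act D g) (twist F x')) (nt_at (\<theta> g) (fobj F x'))"
      "twist ?gF y = Comp D (fmap (act D g) (twist F y')) (nt_at (\<theta> g) (fobj F y'))"
      using F g xy by (simp_all add: twist_conj x'_def y'_def)
    have Lp: "fmap ?gF p = fmap (act C g) (fmap F ?q)"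
      "fmap (conj_func G ?T D g (fobj \<Phi> F)) p = fmap (act D g) (fmap (fobj \<Phi> F) ?q)"
      using g xy by (simp_all add: TC.conj_func_apply TD.conj_func_apply x'_def y'_def)
    \<comment> \<open>The arrows are compared after precomposition with the isomorphism
      \<open>twist ?gF x\<close>. The chain below uses naturality for \<open>gF\<close>, the cocycle
      at \<open>y\<close>, naturality of \<open>\<theta> g\<close>, naturality for \<open>F\<close>
      under \<open>g\<close>, and the cocycle at \<open>x\<close>.\<close>
    show "fmap (fobj \<Phi> ?gF) p = fmap (conj_func G ?T D g (fobj \<Phi> F)) p"
    proof (rule target.iso_arr_cancel_right)
      show "iso_arr D (twist ?gF x)"
        using twist_arr[OF gF xy(2)] by simp
      show "fmap (fobj \<Phi> ?gF) p \<in> Arr D" "fmap (conj_func G ?T D g (fobj \<Phi> F)) p \<in> Arr D"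
        using p by (auto intro: L.fmap_arr R.fmap_arr)
      show "Dom D (fmap (fobj \<Phi> ?gF) p) = Cod D (twist ?gF x)"
        using L.fmap_arr[of p] p xy gF by (simp add: ob)
      show "Dom D (fmap (conj_func G ?T D g (fobj \<Phi> F)) p) = Cod D (twist ?gF x)"
        unfolding Lp tw by (simp add: s)
      have "Comp D (fmap (fobj \<Phi> ?gF) p) (twist ?gF x)
          = Comp D (twist ?gF y) (fmap \<Theta> (fmap (act C g) (fmap F ?q)))"
        using nat[OF gF p] Lp(1) by (simp add: x_def y_def)
      \<comment> \<open>The object \<open>fobj F y'\<close> is written
        \<open>Cod C (fmap F ?q)\<close> so that \<open>theta_natural\<close> matches literally in
        the next step.\<close>
      also have "\<dots> = Comp D (fmap (act D g) (twist F y'))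
          (Comp D (nt_at (\<theta> g) (Cod C (fmap F ?q))) (fmap \<Theta> (fmap (act C g) (fmap F ?q))))"
        unfolding tw by (simp add: s source.act_simps)
      also have "\<dots> = Comp D (fmap (act D g) (Comp D (twist F y') (fmap \<Theta> (fmap F ?q))))
          (nt_at (\<theta> g) (fobj F x'))"
        unfolding theta_natural[OF g q(1)] by (simp add: s)
      also have "\<dots> = Comp D (fmap (conj_func G ?T D g (fobj \<Phi> F)) p) (twist ?gF x)"
        using nat[OF F, of ?q] unfolding Lp tw by (simp add: s)
      finally show "Comp D (fmap (fobj \<Phi> ?gF) p) (twist ?gF x)
          = Comp D (fmap (conj_func G ?T D g (fobj \<Phi> F)) p) (twist ?gF x)" .
    qed
  qed
  \<comment> \<open>The same chain with \<open>nt_at \<eta> z\<close> in place of the arrow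
    \<open>fmap F ?q\<close>, and with \<open>nat2\<close> in place of \<open>nat\<close>.\<close>
  have arr: "fmap \<Phi> (conj_nt G ?T C g \<eta>) = conj_nt G ?T D g (fmap \<Phi> \<eta>)"
    if \<eta>: "natural_transformation ?T C \<eta>" and g: "g \<in> carrier G" for \<eta> g
  proof (rule natural_transformation_eqI)
    interpret \<eta>: natural_transformation ?T C \<eta> by fact
    let ?F = "nt_dom \<eta>" and ?F' = "nt_cod \<eta>" and ?g\<eta> = "conj_nt G ?T C g \<eta>"
    have F: "cat_functor ?T C ?F" "cat_functor ?T C ?F'" by unfold_locales
    interpret \<Phi>\<eta>: natural_transformation ?T D "fmap \<Phi> \<eta>" using \<eta> by (rule \<Phi>\<eta>)
    have g\<eta>: "natural_transformation ?T C ?g\<eta>"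
      using g \<eta> by (rule TC.natural_transformation_conj)
    have gF: "cat_functor ?T C (conj_func G ?T C g ?F)"
      using F g by (simp add: TC.cat_functor_conj)
    show n1: "natural_transformation ?T D (fmap \<Phi> ?g\<eta>)"
      using g\<eta> by (rule \<Phi>\<eta>)
    show n2: "natural_transformation ?T D (conj_nt G ?T D g (fmap \<Phi> \<eta>))"
      using g \<Phi>\<eta>(1)[OF \<eta>] by (rule TD.natural_transformation_conj)
    \<comment> \<open>A transformation carries its two functors as fields, so the object case
      \<open>obj\<close> is needed before components can be compared.\<close>
    show "nt_dom (fmap \<Phi> ?g\<eta>) = nt_dom (conj_nt G ?T D g (fmap \<Phi> \<eta>))"
      "nt_cod (fmap \<Phi> ?g\<eta>) = nt_cod (conj_nt G ?T D g (fmap \<Phi> \<eta>))"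
      using \<eta> g\<eta> g F by (simp_all add: \<Phi>\<eta> TC.conj_nt_simps TD.conj_nt_simps obj)
    fix x assume "x \<in> Obj ?T"
    then have x: "x \<in> carrier G" by simp
    define z where "z = inv g \<otimes> x"
    have z: "z \<in> carrier G" using x g by (simp add: z_def)
    have Fobj: "fobj ?F z \<in> Obj C" "fobj ?F' z \<in> Obj C"
      using \<eta>.dom.fobj_obj[of z] \<eta>.cod.fobj_obj[of z] z by simp_all
    have e: "nt_at \<eta> z \<in> Arr C" "Dom C (nt_at \<eta> z) = fobj ?F z" "Cod C (nt_at \<eta> z) = fobj ?F' z"
      using \<eta>.nt_arr[of z] z by simp_all
    have r: "nt_at (fmap \<Phi> \<eta>) z \<in> Arr D" "Dom D (nt_at (fmap \<Phi> \<eta>) z) = Cod D (twist ?F z)"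
      using \<Phi>\<eta>.nt_arr[of z] z F \<eta> by (simp_all add: \<Phi>\<eta> ob)
    note s = target.act_simps target.arr_simps functor_simps theta_arr twist_arr[OF F(1)]
      twist_arr[OF F(2)] Fobj e r z g
    let ?a = "twist (conj_func G ?T C g ?F) x" and ?a' = "twist (conj_func G ?T C g ?F') x"
    have tw: "?a = Comp D (fmap (act D g) (twist ?F z)) (nt_at (\<theta> g) (fobj ?F z))"
      "?a' = Comp D (fmap (act D g) (twist ?F' z)) (nt_at (\<theta> g) (fobj ?F' z))"
      using F g x by (simp_all add: twist_conj z_def)
    have at_x: "nt_at ?g\<eta> x = fmap (act C g) (nt_at \<eta> z)"
      "nt_at (conj_nt G ?T D g (fmap \<Phi> \<eta>)) x = fmap (act D g) (nt_at (fmap \<Phi> \<eta>) z)"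
      using x g by (simp_all add: TC.conj_nt_simps TD.conj_nt_simps z_def)
    show "nt_at (fmap \<Phi> ?g\<eta>) x = nt_at (conj_nt G ?T D g (fmap \<Phi> \<eta>)) x"
    proof (rule target.iso_arr_cancel_right)
      show "iso_arr D ?a"
        using twist_arr[OF gF x] by simp
      show "nt_at (fmap \<Phi> ?g\<eta>) x \<in> Arr D" "Dom D (nt_at (fmap \<Phi> ?g\<eta>) x) = Cod D ?a"
        using natural_transformation.nt_arr[OF n1, of x] x gF g\<eta>
        by (simp_all add: \<Phi>\<eta> TC.conj_nt_simps ob)
      show "nt_at (conj_nt G ?T D g (fmap \<Phi> \<eta>)) x \<in> Arr D"
        "Dom D (nt_at (conj_nt G ?T D g (fmap \<Phi> \<eta>)) x) = Cod D ?a"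
        unfolding at_x tw by (simp_all add: s)
      have "Comp D (nt_at (fmap \<Phi> ?g\<eta>) x) ?a = Comp D ?a' (fmap \<Theta> (fmap (act C g) (nt_at \<eta> z)))"
        using nat2[OF g\<eta> x] at_x(1) by (simp add: TC.conj_nt_simps)
      also have "\<dots> = Comp D (fmap (act D g) (twist ?F' z))
          (Comp D (nt_at (\<theta> g) (Cod C (nt_at \<eta> z))) (fmap \<Theta> (fmap (act C g) (nt_at \<eta> z))))"
        unfolding tw by (simp add: s source.act_simps)
      also have "\<dots> = Comp D (fmap (act D g) (Comp D (twist ?F' z) (fmap \<Theta> (nt_at \<eta> z))))
          (nt_at (\<theta> g) (fobj ?F z))"
        unfolding theta_natural[OF g e(1)] by (simp add: s)
      also have "\<dots> = Comp D (nt_at (conj_nt G ?T D g (fmap \<Phi> \<eta>)) x) ?a"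
        unfolding nat2[OF \<eta> z] at_x tw by (simp add: s)
      finally show "Comp D (nt_at (fmap \<Phi> ?g\<eta>) x) ?a
          = Comp D (nt_at (conj_nt G ?T D g (fmap \<Phi> \<eta>)) x) ?a" .
    qed
  qed
  show ?thesis
    unfolding \<Phi>_def[symmetric]
  proof
    fix g assume g: "g \<in> carrier G"
    show "comp_func (Cat_tilde G C) \<Phi> (act (Cat_tilde G C) g)
        = comp_func (Cat_tilde G C) (act (Cat_tilde G D) g) \<Phi>"
      \<comment> \<open>Off the functors and transformations both composites are
        \<open>undefined\<close>; on them the claims are \<open>obj\<close> and
        \<open>arr\<close>.\<close>
      using g by (auto simp: comp_func_def compose_def restrict_def fun_eq_iff obj arr \<Phi>F \<Phi>\<eta>)
  qed
qed

end

theorem proposition1p4: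
  fixes G :: "('g, 'x) monoid_scheme"
    and C :: "('o1, 'm1, 'g, 'y) gcat_scheme"
    and D :: "('o2, 'm2, 'g, 'z) gcat_scheme"
    and \<Theta> :: "('o1, 'm1, 'o2, 'm2) func"
    and \<theta> :: "'g \<Rightarrow> ('o1, 'm1, 'o2, 'm2) nat_trans"
  assumes "group G" and "G_category G C" and "G_category G D"
    and "pseudo_equivariant_functor G C D \<Theta> \<theta>"
  shows "\<exists>\<Phi>. equivariant_functor G (Cat_tilde G C) (Cat_tilde G D) \<Phi> \<and>
             induced_by_pseudo G C D \<Theta> \<theta> \<Phi> \<and>
             (\<forall>H. subgroup H G \<longrightarrow>
                cat_functor (htpy_fixed_cat G C H) (htpy_fixed_cat G D H)
                  (restrict_func (htpy_fixed_cat G C H) \<Phi>))"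
proof -
  interpret pseudo_equivariant_functor G C D \<Theta> \<theta> by fact
  obtain \<alpha> where iso: "natural_isomorphism (Cat_tilde G C) (Cat_tilde G D) \<alpha>"
    and dom: "nt_dom \<alpha> = postcomp (translation_cat G) C \<Theta>"
    and at: "\<And>F. cat_functor (translation_cat G) C F \<Longrightarrow> nt_at (nt_at \<alpha> F) = twist F"
    using twist_transport by blast
  have eq: "equivariant_functor G (Cat_tilde G C) (Cat_tilde G D) (nt_cod \<alpha>)"
    using iso dom at by (rule equivariant_functor_of_twist)
  \<comment> \<open>The same \<alpha> is the witness, since \<open>twist\<close> unfolds to the
    prescribed components.\<close>
  moreover have "induced_by_pseudo G C D \<Theta> \<theta> (nt_cod \<alpha>)"
    unfolding induced_by_pseudo_def using iso dom at
    by (intro exI[of _ \<alpha>]) (simp add: twist_def)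
  \<comment> \<open>Homotopy fixed points are the strict fixed points of \<open>Cat_tilde\<close>,
    so strict equivariance of the induced functor is all that is used.\<close>
  moreover have "cat_functor (htpy_fixed_cat G C H) (htpy_fixed_cat G D H)
      (restrict_func (htpy_fixed_cat G C H) (nt_cod \<alpha>))" if "subgroup H G" for H
    unfolding htpy_fixed_cat_def
    by (intro equivariant_functor.cat_functor_fixed_cat[OF eq] subgroup.subset that)
  ultimately show ?thesis by blast
qed

end
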